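(* Let $\mathcal{A}$ be a category and $\Sigma$ a class of arrows of $\mathcal{A}$ containing the identities. Let $f,g:X\to Y$ be arrows of $\mathcal{A}$ and let $H,H'$ be two homotopies from $f$ to $g$ which are related by the germ relation. Then $[H]=[H']$ in $\mathcal{H}o(\mathcal{A})$; that is, $\widehat{FH}=\widehat{FH'}$ for every 2-category $\mathcal{D}$ and every 2-functor $F:\mathcal{A}\to\mathcal{D}$ sending the arrows of $\Sigma$ to equivalences.
   Context: A category is regarded as a 2-category with only identity 2-cells; an arrow is identified with its identity 2-cell. An arrow $f:X\to Y$ of a 2-category is an equivalence if there are $g:Y\to X$ and invertible 2-cells $id_X\Rightarrow gf$, $fg\Rightarrow id_Y$. A cylinder $C=(W,Z,d_0,d_1,s,x)$ for an object $X$ consists of arrows $d_0,d_1:X\to W$, $s:W\to Z$, $x:X\to Z$ of $\mathcal{A}$ with $s\in\Sigma$ and $sd_0=sd_1=x$. A homotopy $H=(C,h)$ from $f$ to $g$ is a cylinder $C$ for $X$ with an arrow $h:W\to Y$ such that $hd_0=f$, $hd_1=g$. If $F:\mathcal{A}\to\mathcal{D}$ is a 2-functor into a 2-category sending $\Sigma$ to equivalences, there is a unique 2-cell $\widehat{FC}:Fd_0\Rightarrow Fd_1$ with $Fs\,\widehat{FC}=Fx$ (the identity 2-cell); put $\widehat{FH}=Fh\,\widehat{FC}:Ff\Rightarrow Fg$. The 2-cells of the homotopy 2-category $\mathcal{H}o(\mathcal{A})$ are classes of finite sequences of composable homotopies, two being equivalent iff their (vertically composed) images $\widehat{F(-)}$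 agree for all such $F$ and $\mathcal{D}$; $[H]$ is the class of the one-term sequence $H$. A cylinder map $C\to C'=(W',Z',d_0',d_1',s',x')$ between cylinders for $X$ is a pair $\phi:W\to W'$, $\psi:Z\to Z'$ with $\phi d_0=d_0'$, $\phi d_1=d_1'$, $s'\phi=\psi s$, $\psi x=x'$. The germ relation on homotopies from $f$ to $g$ is the equivalence relation generated by relating $H=(C,h)$ and $H'=(C',h')$ whenever there is a cylinder map $(\phi,\psi):C\to C'$ with $h'\phi=h$. *)

theory Defs
  imports Main
begin

record ('o, 'm) cat =
  Obj :: "'o set"
  Arr :: "'m set"
  Dom :: "'m \<Rightarrow> 'o"
  Cod :: "'m \<Rightarrow> 'o"
  Idn :: "'o \<Rightarrow> 'm"
  Cmp :: "'m \<Rightarrow> 'm \<Rightarrow> 'm"  (infixr "\<cdot>\<index>" 70)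

definition hom :: "('o, 'm, 'z) cat_scheme \<Rightarrow> 'o \<Rightarrow> 'o \<Rightarrow> 'm set" where
  "hom C X Y = {f \<in> Arr C. Dom C f = X \<and> Cod C f = Y}"

locale category =
  fixes C :: "('o, 'm, 'z) cat_scheme" (structure)
  assumes Dom_obj: "f \<in> Arr C \<Longrightarrow> Dom C f \<in> Obj C"
    and Cod_obj: "f \<in> Arr C \<Longrightarrow> Cod C f \<in> Obj C"
    and Idn_hom: "X \<in> Obj C \<Longrightarrow> Idn C X \<in> hom C X X"
    and Cmp_hom: "f \<in> hom C X Y \<Longrightarrow> g \<in> hom C Y Z \<Longrightarrow> g \<cdot> f \<in> hom C X Z"
    and Cmp_Idn: "f \<in> hom C X Y \<Longrightarrow> f \<cdot> Idn C X = f"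
    and Idn_Cmp: "f \<in> hom C X Y \<Longrightarrow> Idn C Y \<cdot> f = f"
    and Cmp_assoc: "f \<in> hom C X Y \<Longrightarrow> g \<in> hom C Y Z \<Longrightarrow> h \<in> hom C Z W
                      \<Longrightarrow> (h \<cdot> g) \<cdot> f = h \<cdot> (g \<cdot> f)"

record ('o, 'm, 'c) two_cat = "('o, 'm) cat" +
  Cell :: "'c set"
  Dom2 :: "'c \<Rightarrow> 'm"
  Cod2 :: "'c \<Rightarrow> 'm"
  Id2  :: "'m \<Rightarrow> 'c"
  VCmp :: "'c \<Rightarrow> 'c \<Rightarrow> 'c"  (infixr "\<bullet>\<index>" 70)
  HCmp :: "'c \<Rightarrow> 'c \<Rightarrow> 'c"  (infixr "\<star>\<index>" 75)

definition vertical :: "('o, 'm, 'c) two_cat \<Rightarrow> ('m, 'c) cat" where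
  "vertical D = \<lparr>Obj = Arr D, Arr = Cell D, Dom = Dom2 D, Cod = Cod2 D,
                 Idn = Id2 D, Cmp = VCmp D\<rparr>"

definition horizontal :: "('o, 'm, 'c) two_cat \<Rightarrow> ('o, 'c) cat" where
  "horizontal D = \<lparr>Obj = Obj D, Arr = Cell D,
                   Dom = (\<lambda>\<alpha>. Dom D (Dom2 D \<alpha>)), Cod = (\<lambda>\<alpha>. Cod D (Dom2 D \<alpha>)),
                   Idn = (\<lambda>X. Id2 D (Idn D X)), Cmp = HCmp D\<rparr>"

definition cells :: "('o, 'm, 'c) two_cat \<Rightarrow> 'm \<Rightarrow> 'm \<Rightarrow> 'c set" where
  "cells D f g = hom (vertical D) f g"

text \<open>A strict 2-category: arrows with their 2-cells form a category under vertical composition,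
  objects with 2-cells form a category under horizontal composition, and the two are compatible.
  Whiskering by an arrow is horizontal composition with its identity 2-cell.\<close>

locale two_category = category D for D :: "('o, 'm, 'c) two_cat" (structure) +
  assumes vertical_category: "category (vertical D)"
    and horizontal_category: "category (horizontal D)"
    and Dom_parallel: "\<alpha> \<in> Cell D \<Longrightarrow> Dom D (Cod2 D \<alpha>) = Dom D (Dom2 D \<alpha>)"
    and Cod_parallel: "\<alpha> \<in> Cell D \<Longrightarrow> Cod D (Cod2 D \<alpha>) = Cod D (Dom2 D \<alpha>)"
    and HCmp_cells: "\<alpha> \<in> cells D f f' \<Longrightarrow> \<beta> \<in> cells D g g' \<Longrightarrow> Dom D g = Cod D f
                       \<Longrightarrow> \<beta> \<star> \<alpha> \<in> cells D (g \<cdot> f) (g' \<cdot> f')"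
    and HCmp_Id2: "f \<in> hom D X Y \<Longrightarrow> g \<in> hom D Y Z \<Longrightarrow> Id2 D g \<star> Id2 D f = Id2 D (g \<cdot> f)"
    and interchange: "\<alpha> \<in> cells D f f' \<Longrightarrow> \<alpha>' \<in> cells D f' f'' \<Longrightarrow>
                      \<beta> \<in> cells D g g' \<Longrightarrow> \<beta>' \<in> cells D g' g'' \<Longrightarrow> Dom D g = Cod D f
                        \<Longrightarrow> (\<beta>' \<bullet> \<beta>) \<star> (\<alpha>' \<bullet> \<alpha>) = (\<beta>' \<star> \<alpha>') \<bullet> (\<beta> \<star> \<alpha>)"

definition invertible_cell :: "('o, 'm, 'c) two_cat \<Rightarrow> 'm \<Rightarrow> 'm \<Rightarrow> 'c \<Rightarrow> bool" where
  "invertible_cell D f g \<alpha> \<longleftrightarrow> \<alpha> \<in> cells D f g \<and>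
     (\<exists>\<beta> \<in> cells D g f. VCmp D \<beta> \<alpha> = Id2 D f \<and> VCmp D \<alpha> \<beta> = Id2 D g)"

definition equivalence :: "('o, 'm, 'c) two_cat \<Rightarrow> 'm \<Rightarrow> bool" where
  "equivalence D f \<longleftrightarrow> f \<in> Arr D \<and>
     (\<exists>g \<in> hom D (Cod D f) (Dom D f).
        (\<exists>\<eta>. invertible_cell D (Idn D (Dom D f)) (Cmp D g f) \<eta>) \<and>
        (\<exists>\<epsilon>. invertible_cell D (Cmp D f g) (Idn D (Cod D f)) \<epsilon>))"

text \<open>A category as a 2-category with only identity 2-cells: the 2-cells are the arrows, each
  being its own identity 2-cell.\<close>

definition locally_discrete :: "('o, 'm) cat \<Rightarrow> ('o, 'm, 'm) two_cat" where
  "locally_discrete A = \<lparr>Obj = Obj A, Arr = Arr A, Dom = Dom A, Cod = Cod A,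
     Idn = Idn A, Cmp = Cmp A, Cell = Arr A, Dom2 = (\<lambda>f. f), Cod2 = (\<lambda>f. f),
     Id2 = (\<lambda>f. f), VCmp = (\<lambda>g f. f), HCmp = Cmp A\<rparr>"

lemma two_category_locally_discrete:
  assumes "category A"
  shows "two_category (locally_discrete A)"
proof -
  interpret category A by fact
  have idn: "Idn A X \<in> Arr A \<and> Dom A (Idn A X) = X \<and> Cod A (Idn A X) = X" if "X \<in> Obj A" for X
    using Idn_hom[OF that] by (simp add: hom_def)
  have cmp: "Cmp A g f \<in> Arr A \<and> Dom A (Cmp A g f) = Dom A f \<and> Cod A (Cmp A g f) = Cod A g"
    if "f \<in> Arr A" "g \<in> Arr A" "Dom A g = Cod A f" for f g
    using that Cmp_hom[of f "Dom A f" "Cod A f" g "Cod A g"] by (simp add: hom_def)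
  show ?thesis
    by unfold_locales
      (auto simp: locally_discrete_def vertical_def horizontal_def cells_def hom_def Dom_obj Cod_obj
        idn cmp Cmp_Idn Idn_Cmp intro: Cmp_assoc)
qed

record ('o, 'm, 'c, 'p, 'n, 'd) two_map =
  MObj :: "'o \<Rightarrow> 'p"
  MArr :: "'m \<Rightarrow> 'n"
  MCell :: "'c \<Rightarrow> 'd"

locale two_functor = source: two_category B + target: two_category D
  for B :: "('o, 'm, 'c) two_cat" and D :: "('p, 'n, 'd) two_cat" +
  fixes F :: "('o, 'm, 'c, 'p, 'n, 'd) two_map"
  assumes MObj_obj: "X \<in> Obj B \<Longrightarrow> MObj F X \<in> Obj D"
    and MArr_hom: "f \<in> hom B X Y \<Longrightarrow> MArr F f \<in> hom D (MObj F X) (MObj F Y)"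
    and MCell_cells: "\<alpha> \<in> cells B f g \<Longrightarrow> MCell F \<alpha> \<in> cells D (MArr F f) (MArr F g)"
    and MArr_Idn: "X \<in> Obj B \<Longrightarrow> MArr F (Idn B X) = Idn D (MObj F X)"
    and MArr_Cmp: "f \<in> hom B X Y \<Longrightarrow> g \<in> hom B Y Z
                     \<Longrightarrow> MArr F (Cmp B g f) = Cmp D (MArr F g) (MArr F f)"
    and MCell_Id2: "f \<in> Arr B \<Longrightarrow> MCell F (Id2 B f) = Id2 D (MArr F f)"
    and MCell_VCmp: "\<alpha> \<in> cells B f g \<Longrightarrow> \<beta> \<in> cells B g h
                       \<Longrightarrow> MCell F (VCmp B \<beta> \<alpha>) = VCmp D (MCell F \<beta>) (MCell F \<alpha>)"
    and MCell_HCmp: "\<alpha> \<in> cells B f f' \<Longrightarrow> \<beta> \<in> cells B g g' \<Longrightarrow> Dom B g = Cod B f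
                       \<Longrightarrow> MCell F (HCmp B \<beta> \<alpha>) = HCmp D (MCell F \<beta>) (MCell F \<alpha>)"

definition sends_to_equivalences ::
    "('o, 'm, 'c, 'p, 'n, 'd) two_map \<Rightarrow> 'm set \<Rightarrow> ('p, 'n, 'd) two_cat \<Rightarrow> bool" where
  "sends_to_equivalences F \<Sigma> D \<longleftrightarrow> (\<forall>s \<in> \<Sigma>. equivalence D (MArr F s))"

record ('o, 'm) cylinder =
  cW :: 'o
  cZ :: 'o
  cd0 :: 'm
  cd1 :: 'm
  cs :: 'm
  cx :: 'm

definition is_cylinder :: "('o, 'm) cat \<Rightarrow> 'm set \<Rightarrow> 'o \<Rightarrow> ('o, 'm) cylinder \<Rightarrow> bool" where
  "is_cylinder A \<Sigma> X C \<longleftrightarrow>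
     X \<in> Obj A \<and> cW C \<in> Obj A \<and> cZ C \<in> Obj A \<and>
     cd0 C \<in> hom A X (cW C) \<and> cd1 C \<in> hom A X (cW C) \<and>
     cs C \<in> hom A (cW C) (cZ C) \<and> cx C \<in> hom A X (cZ C) \<and>
     cs C \<in> \<Sigma> \<and> Cmp A (cs C) (cd0 C) = cx C \<and> Cmp A (cs C) (cd1 C) = cx C"

record ('o, 'm) homotopy =
  hcyl :: "('o, 'm) cylinder"
  hmap :: 'm

definition is_homotopy ::
    "('o, 'm) cat \<Rightarrow> 'm set \<Rightarrow> 'o \<Rightarrow> 'o \<Rightarrow> 'm \<Rightarrow> 'm \<Rightarrow> ('o, 'm) homotopy \<Rightarrow> bool" where
  "is_homotopy A \<Sigma> X Y f g H \<longleftrightarrow>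
     is_cylinder A \<Sigma> X (hcyl H) \<and> hmap H \<in> hom A (cW (hcyl H)) Y \<and>
     Cmp A (hmap H) (cd0 (hcyl H)) = f \<and> Cmp A (hmap H) (cd1 (hcyl H)) = g"

text \<open>The hat of a cylinder is the unique 2-cell with the stated property when \<open>F\<close> sends
  \<open>\<Sigma>\<close> to equivalences.\<close>

definition cyl_hat ::
    "('p, 'n, 'd) two_cat \<Rightarrow> ('o, 'm, 'c, 'p, 'n, 'd) two_map \<Rightarrow> ('o, 'm) cylinder \<Rightarrow> 'd" where
  "cyl_hat D F C = (THE \<gamma>. \<gamma> \<in> cells D (MArr F (cd0 C)) (MArr F (cd1 C)) \<and>
     HCmp D (Id2 D (MArr F (cs C))) \<gamma> = Id2 D (MArr F (cx C)))"

definition homotopy_hat ::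
    "('p, 'n, 'd) two_cat \<Rightarrow> ('o, 'm, 'c, 'p, 'n, 'd) two_map \<Rightarrow> ('o, 'm) homotopy \<Rightarrow> 'd" where
  "homotopy_hat D F H = HCmp D (Id2 D (MArr F (hmap H))) (cyl_hat D F (hcyl H))"

fun homotopy_seq ::
    "('o, 'm) cat \<Rightarrow> 'm set \<Rightarrow> 'o \<Rightarrow> 'o \<Rightarrow> 'm \<Rightarrow> 'm \<Rightarrow> ('o, 'm) homotopy list \<Rightarrow> bool" where
  "homotopy_seq A \<Sigma> X Y f g [] \<longleftrightarrow> f \<in> hom A X Y \<and> f = g"
| "homotopy_seq A \<Sigma> X Y f g (H # Hs) \<longleftrightarrow>
     (\<exists>k \<in> hom A X Y. is_homotopy A \<Sigma> X Y f k H \<and> homotopy_seq A \<Sigma> X Y k g Hs)"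

text \<open>The vertical composite of the hats of a sequence ending at \<open>g\<close>; the head of the list is
  the homotopy applied first.\<close>

fun seq_hat ::
    "('p, 'n, 'd) two_cat \<Rightarrow> ('o, 'm, 'c, 'p, 'n, 'd) two_map \<Rightarrow> 'm
       \<Rightarrow> ('o, 'm) homotopy list \<Rightarrow> 'd" where
  "seq_hat D F g [] = Id2 D (MArr F g)"
| "seq_hat D F g (H # Hs) = VCmp D (seq_hat D F g Hs) (homotopy_hat D F H)"

text \<open>HOL cannot quantify over types inside a definition, so the types of the objects, arrows and
  2-cells of the test 2-categories \<open>D\<close> are passed as a type argument, which is left arbitrary.\<close>

definition ho_equiv ::
    "('p \<times> 'n \<times> 'd) itself \<Rightarrow> ('o, 'm) cat \<Rightarrow> 'm set \<Rightarrow> 'm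
       \<Rightarrow> ('o, 'm) homotopy list \<Rightarrow> ('o, 'm) homotopy list \<Rightarrow> bool" where
  "ho_equiv T A \<Sigma> g Hs Hs' \<longleftrightarrow>
     (\<forall>(D :: ('p, 'n, 'd) two_cat) F.
        two_category D \<and> two_functor (locally_discrete A) D F \<and> sends_to_equivalences F \<Sigma> D
          \<longrightarrow> seq_hat D F g Hs = seq_hat D F g Hs')"

definition ho_class ::
    "('p \<times> 'n \<times> 'd) itself \<Rightarrow> ('o, 'm) cat \<Rightarrow> 'm set \<Rightarrow> 'o \<Rightarrow> 'o \<Rightarrow> 'm \<Rightarrow> 'm
       \<Rightarrow> ('o, 'm) homotopy list \<Rightarrow> ('o, 'm) homotopy list set" where
  "ho_class T A \<Sigma> X Y f g Hs = {Hs'. homotopy_seq A \<Sigma> X Y f g Hs' \<and> ho_equiv T A \<Sigma> g Hs Hs'}"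

definition is_cylinder_map ::
    "('o, 'm) cat \<Rightarrow> ('o, 'm) cylinder \<Rightarrow> ('o, 'm) cylinder \<Rightarrow> 'm \<Rightarrow> 'm \<Rightarrow> bool" where
  "is_cylinder_map A C C' \<phi> \<psi> \<longleftrightarrow>
     \<phi> \<in> hom A (cW C) (cW C') \<and> \<psi> \<in> hom A (cZ C) (cZ C') \<and>
     Cmp A \<phi> (cd0 C) = cd0 C' \<and> Cmp A \<phi> (cd1 C) = cd1 C' \<and>
     Cmp A (cs C') \<phi> = Cmp A \<psi> (cs C) \<and> Cmp A \<psi> (cx C) = cx C'"

definition germ_step ::
    "('o, 'm) cat \<Rightarrow> 'm set \<Rightarrow> 'o \<Rightarrow> 'o \<Rightarrow> 'm \<Rightarrow> 'm
       \<Rightarrow> ('o, 'm) homotopy \<Rightarrow> ('o, 'm) homotopy \<Rightarrow> bool" where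
  "germ_step A \<Sigma> X Y f g H H' \<longleftrightarrow>
     is_homotopy A \<Sigma> X Y f g H \<and> is_homotopy A \<Sigma> X Y f g H' \<and>
     (\<exists>\<phi> \<psi>. is_cylinder_map A (hcyl H) (hcyl H') \<phi> \<psi> \<and> Cmp A (hmap H') \<phi> = hmap H)"

definition germ_related ::
    "('o, 'm) cat \<Rightarrow> 'm set \<Rightarrow> 'o \<Rightarrow> 'o \<Rightarrow> 'm \<Rightarrow> 'm
       \<Rightarrow> ('o, 'm) homotopy \<Rightarrow> ('o, 'm) homotopy \<Rightarrow> bool" where
  "germ_related A \<Sigma> X Y f g = equivclp (germ_step A \<Sigma> X Y f g)"

end

theory Submission
  imports Defs
begin

text \<open>Whiskering with an equivalence is bijective on 2-cells, so the hat of a cylinder is the only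
  2-cell \<open>Fd\<^sub>0 \<Rightarrow> Fd\<^sub>1\<close> that \<open>Fs\<close> sends to an identity. Along a cylinder map \<open>(\<phi>, \<psi>)\<close> the hat
  of \<open>C\<close> whiskered with \<open>F\<phi>\<close> has the property that characterises the hat of \<open>C'\<close>, because
  \<open>s' \<phi> = \<psi> s\<close>; whiskering with \<open>Fh'\<close> then identifies the hats of the two homotopies.\<close>

context two_category
begin

section \<open>Boundaries, identities and the two compositions of 2-cells\<close>

lemma homI: "f \<in> Arr D \<Longrightarrow> Dom D f = X \<Longrightarrow> Cod D f = Y \<Longrightarrow> f \<in> hom D X Y"
  by (simp add: hom_def)

lemma cells_iff: "\<alpha> \<in> cells D f g \<longleftrightarrow> \<alpha> \<in> Cell D \<and> Dom2 D \<alpha> = f \<and> Cod2 D \<alpha> = g"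
  by (simp add: cells_def hom_def vertical_def)

lemma cells_arr:
  assumes "\<alpha> \<in> cells D f g"
  shows "f \<in> Arr D" "g \<in> Arr D" "Dom D g = Dom D f" "Cod D g = Cod D f"
  using assms category.Dom_obj[OF vertical_category, of \<alpha>] category.Cod_obj[OF vertical_category, of \<alpha>]
    Dom_parallel[of \<alpha>] Cod_parallel[of \<alpha>]
  by (auto simp: cells_iff vertical_def)

lemma Id2_cells: "f \<in> Arr D \<Longrightarrow> Id2 D f \<in> cells D f f"
  using category.Idn_hom[OF vertical_category, of f] by (simp add: cells_def vertical_def)

lemma VCmp_cells: "\<alpha> \<in> cells D f g \<Longrightarrow> \<beta> \<in> cells D g h \<Longrightarrow> \<beta> \<bullet> \<alpha> \<in> cells D f h"
  using category.Cmp_hom[OF vertical_category, of \<alpha> f g \<beta> h] by (simp add: cells_def vertical_def)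

lemma VCmp_Id2: "\<alpha> \<in> cells D f g \<Longrightarrow> \<alpha> \<bullet> Id2 D f = \<alpha>"
  using category.Cmp_Idn[OF vertical_category, of \<alpha> f g] by (simp add: cells_def vertical_def)

lemma Id2_VCmp: "\<alpha> \<in> cells D f g \<Longrightarrow> Id2 D g \<bullet> \<alpha> = \<alpha>"
  using category.Idn_Cmp[OF vertical_category, of \<alpha> f g] by (simp add: cells_def vertical_def)

lemma VCmp_assoc:
  "\<alpha> \<in> cells D f g \<Longrightarrow> \<beta> \<in> cells D g h \<Longrightarrow> \<gamma> \<in> cells D h k \<Longrightarrow> (\<gamma> \<bullet> \<beta>) \<bullet> \<alpha> = \<gamma> \<bullet> (\<beta> \<bullet> \<alpha>)"
  using category.Cmp_assoc[OF vertical_category, of \<alpha> f g \<beta> h \<gamma> k]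
  by (simp add: cells_def vertical_def)

lemma HCmp_assoc:
  assumes "\<alpha> \<in> cells D f f'" "\<beta> \<in> cells D g g'" "\<gamma> \<in> cells D h h'"
    and "Dom D g = Cod D f" "Dom D h = Cod D g"
  shows "(\<gamma> \<star> \<beta>) \<star> \<alpha> = \<gamma> \<star> (\<beta> \<star> \<alpha>)"
  using assms category.Cmp_assoc[OF horizontal_category, of \<alpha> "Dom D f" "Cod D f" \<beta> "Cod D g" \<gamma> "Cod D h"]
  by (simp add: hom_def horizontal_def cells_iff)

lemma Id2_Idn_HCmp:
  assumes "\<alpha> \<in> cells D f g"
  shows "Id2 D (Idn D (Cod D f)) \<star> \<alpha> = \<alpha>"
  using assms category.Idn_Cmp[OF horizontal_category, of \<alpha> "Dom D f" "Cod D f"]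
  by (simp add: hom_def horizontal_def cells_iff)

lemma Id2_HCmp_Id2:
  "f \<in> Arr D \<Longrightarrow> g \<in> Arr D \<Longrightarrow> Dom D g = Cod D f \<Longrightarrow> Id2 D g \<star> Id2 D f = Id2 D (g \<cdot> f)"
  by (rule HCmp_Id2[of f "Dom D f" "Cod D f" g "Cod D g"]) (simp_all add: hom_def)

section \<open>Whiskering by arrows and by equivalences\<close>

lemma whisker_comp:
  assumes "\<alpha> \<in> cells D u v" "g \<in> Arr D" "h \<in> Arr D" "Dom D g = Cod D u" "Dom D h = Cod D g"
  shows "Id2 D h \<star> (Id2 D g \<star> \<alpha>) = Id2 D (h \<cdot> g) \<star> \<alpha>"
  using HCmp_assoc[OF assms(1) Id2_cells[OF assms(2)] Id2_cells[OF assms(3)]] Id2_HCmp_Id2[of g h] assms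
  by simp

lemma whisker_cells:
  assumes "\<alpha> \<in> cells D u v" "g \<in> Arr D" "Dom D g = Cod D u"
  shows "Id2 D g \<star> \<alpha> \<in> cells D (g \<cdot> u) (g \<cdot> v)"
  using HCmp_cells[OF assms(1) Id2_cells] assms by simp

text \<open>Both sides are the horizontal composite \<open>\<eta> \<star> \<gamma>\<close>, which
  interchange splits in two orders. It is used with \<open>q = t \<cdot> s\<close> and
  \<open>\<eta>\<close> the unit of an equivalence.\<close>

lemma unit_naturality:
  assumes eta: "\<eta> \<in> cells D (Idn D (Cod D u)) q" and gamma: "\<gamma> \<in> cells D u v"
  shows "(Id2 D q \<star> \<gamma>) \<bullet> (\<eta> \<star> Id2 D u) = (\<eta> \<star> Id2 D v) \<bullet> \<gamma>"
proof -
  have u: "u \<in> Arr D" "v \<in> Arr D" "Cod D v = Cod D u" and q: "q \<in> Arr D"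
    using cells_arr[OF gamma] cells_arr[OF eta] by auto
  let ?i = "Idn D (Cod D u)"
  have i: "?i \<in> Arr D" "Dom D ?i = Cod D u"
    using Idn_hom[OF Cod_obj[OF u(1)]] by (auto simp: hom_def)
  have "(Id2 D q \<star> \<gamma>) \<bullet> (\<eta> \<star> Id2 D u) = (Id2 D q \<bullet> \<eta>) \<star> (\<gamma> \<bullet> Id2 D u)"
    using interchange[OF Id2_cells gamma eta Id2_cells] u q i by simp
  also have "\<dots> = (\<eta> \<bullet> Id2 D ?i) \<star> (Id2 D v \<bullet> \<gamma>)"
    by (simp add: VCmp_Id2[OF gamma] VCmp_Id2[OF eta] Id2_VCmp[OF gamma] Id2_VCmp[OF eta])
  also have "\<dots> = (\<eta> \<star> Id2 D v) \<bullet> (Id2 D ?i \<star> \<gamma>)"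
    using interchange[OF gamma Id2_cells Id2_cells eta] u i by simp
  finally show ?thesis
    by (simp add: Id2_Idn_HCmp[OF gamma])
qed

text \<open>The inverse is the whiskered inverse \<open>\<theta> \<star> Id2 D u\<close>: by
  interchange the composites are computed factor by factor, and \<open>Id2 D u\<close> is
  idempotent.\<close>

lemma invertible_HCmp_Id2:
  assumes "invertible_cell D p q \<eta>" "u \<in> Arr D" "Dom D p = Cod D u"
  shows "invertible_cell D (p \<cdot> u) (q \<cdot> u) (\<eta> \<star> Id2 D u)"
proof -
  obtain \<theta> where eta: "\<eta> \<in> cells D p q" and theta: "\<theta> \<in> cells D q p"
    and inv: "\<theta> \<bullet> \<eta> = Id2 D p" "\<eta> \<bullet> \<theta> = Id2 D q"
    using assms(1) by (auto simp: invertible_cell_def)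
  have pq: "p \<in> Arr D" "q \<in> Arr D" "Dom D q = Cod D u"
    using cells_arr[OF eta] assms(3) by auto
  have u: "Id2 D u \<in> cells D u u" "Id2 D u \<bullet> Id2 D u = Id2 D u"
    using Id2_cells[OF assms(2)] VCmp_Id2 by auto
  have "(\<theta> \<star> Id2 D u) \<bullet> (\<eta> \<star> Id2 D u) = Id2 D (p \<cdot> u)"
    using interchange[OF u(1) u(1) eta theta] u(2) inv(1) Id2_HCmp_Id2 assms pq by simp
  moreover have "(\<eta> \<star> Id2 D u) \<bullet> (\<theta> \<star> Id2 D u) = Id2 D (q \<cdot> u)"
    using interchange[OF u(1) u(1) theta eta] u(2) inv(2) Id2_HCmp_Id2 assms pq by simp
  ultimately show ?thesis
    using HCmp_cells[OF u(1) eta] HCmp_cells[OF u(1) theta] assms(3) pq(3)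
    by (auto simp: invertible_cell_def)
qed

text \<open>Whiskering further with \<open>t\<close> gives whiskering with
  \<open>t \<cdot> s\<close>, and the unit, being natural and invertible, recovers the 2-cell from
  that. The hypotheses name \<open>t\<close> and \<open>\<eta>\<close> explicitly so that the roles
  of \<open>s\<close> and \<open>t\<close> can be exchanged, with the inverse counit as
  unit.\<close>

lemma whisker_injective:
  assumes s: "s \<in> Arr D" and t: "t \<in> hom D (Cod D s) (Dom D s)"
    and eta: "invertible_cell D (Idn D (Dom D s)) (t \<cdot> s) \<eta>"
    and gamma: "\<gamma> \<in> cells D u v" "\<gamma>' \<in> cells D u v" and u: "Cod D u = Dom D s"
    and eq: "Id2 D s \<star> \<gamma> = Id2 D s \<star> \<gamma>'"
  shows "\<gamma> = \<gamma>'"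
proof -
  have v: "v \<in> Arr D" "Cod D v = Dom D s"
    using cells_arr[OF gamma(1)] u by auto
  have i: "Idn D (Dom D s) \<in> Arr D" "Dom D (Idn D (Dom D s)) = Dom D s"
    using Idn_hom[OF Dom_obj[OF s]] by (auto simp: hom_def)
  have eta': "\<eta> \<in> cells D (Idn D (Cod D u)) (t \<cdot> s)"
    using eta u by (simp add: invertible_cell_def)
  \<comment> \<open>By naturality both sides equal the whiskering with \<open>t \<cdot> s\<close>
    after \<open>\<eta> \<star> Id2 D u\<close>, and \<open>eq\<close> makes these whiskerings
    agree.\<close>
  have *: "(\<eta> \<star> Id2 D v) \<bullet> \<gamma> = (\<eta> \<star> Id2 D v) \<bullet> \<gamma>'"
    using unit_naturality[OF eta' gamma(1)] unit_naturality[OF eta' gamma(2)]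
      whisker_comp[OF gamma(1) s, of t] whisker_comp[OF gamma(2) s, of t] t u eq
    by (simp add: hom_def)
  \<comment> \<open>This makes \<open>v\<close> itself the source of
    \<open>\<eta> \<star> Id2 D v\<close>, so that its inverse \<open>\<theta>\<close> can be
    composed on the left to cancel it.\<close>
  have "Idn D (Dom D s) \<cdot> v = v"
    using Idn_Cmp[OF homI[OF v(1) refl v(2)]] .
  then obtain \<theta> where \<theta>: "\<theta> \<in> cells D ((t \<cdot> s) \<cdot> v) v" "\<theta> \<bullet> (\<eta> \<star> Id2 D v) = Id2 D v"
    and c: "\<eta> \<star> Id2 D v \<in> cells D v ((t \<cdot> s) \<cdot> v)"
    using invertible_HCmp_Id2[OF eta v(1)] i v by (auto simp: invertible_cell_def)
  show ?thesis
    using VCmp_assoc[OF gamma(1) c \<theta>(1)] VCmp_assoc[OF gamma(2) c \<theta>(1)] * \<theta>(2)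
      Id2_VCmp gamma by simp
qed

text \<open>A preimage of \<open>\<delta>\<close> is the conjugate of \<open>t \<star> \<delta>\<close> by the unit; it is only seen to
  be a preimage after whiskering with \<open>t\<close>, which suffices since \<open>t\<close> is an equivalence as well.\<close>

lemma whisker_bijective:
  assumes "equivalence D s"
    and u: "u \<in> hom D X (Dom D s)" and v: "v \<in> hom D X (Dom D s)"
  shows "bij_betw (\<lambda>\<gamma>. Id2 D s \<star> \<gamma>) (cells D u v) (cells D (s \<cdot> u) (s \<cdot> v))"
proof -
  obtain t \<eta> \<epsilon> where s: "s \<in> Arr D" and t: "t \<in> hom D (Cod D s) (Dom D s)"
    and eta: "invertible_cell D (Idn D (Dom D s)) (t \<cdot> s) \<eta>"
    and eps: "invertible_cell D (s \<cdot> t) (Idn D (Cod D s)) \<epsilon>"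
    using assms(1) unfolding equivalence_def by blast
  \<comment> \<open>The inverse of the counit is a unit for \<open>t\<close>, with \<open>s\<close>
    as its quasi-inverse.\<close>
  obtain \<epsilon>' where eps': "invertible_cell D (Idn D (Cod D s)) (s \<cdot> t) \<epsilon>'"
    using eps by (auto simp: invertible_cell_def)
  have t': "t \<in> Arr D" "Dom D t = Cod D s" "Cod D t = Dom D s"
    and u': "u \<in> Arr D" "Cod D u = Dom D s" and v': "v \<in> Arr D" "Cod D v = Dom D s"
    using t u v by (auto simp: hom_def)
  have s': "s \<in> hom D (Dom D s) (Cod D s)"
    using s by (simp add: hom_def)
  have inj: "inj_on (\<lambda>\<gamma>. Id2 D s \<star> \<gamma>) (cells D u v)"
    using whisker_injective[OF s t eta] u' by (auto simp: inj_on_def)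
  have surj: "\<exists>\<gamma> \<in> cells D u v. Id2 D s \<star> \<gamma> = \<delta>" if delta: "\<delta> \<in> cells D (s \<cdot> u) (s \<cdot> v)" for \<delta>
  proof -
    let ?q = "t \<cdot> s"
    have su: "Cod D (s \<cdot> u) = Cod D s"
      using Cmp_hom[OF u s'] by (simp add: hom_def)
    have assoc: "t \<cdot> (s \<cdot> u) = ?q \<cdot> u" "t \<cdot> (s \<cdot> v) = ?q \<cdot> v"
      using Cmp_assoc[OF u s' t] Cmp_assoc[OF v s' t] by auto
    have i: "Dom D (Idn D (Dom D s)) = Dom D s"
      using Idn_hom[OF Dom_obj[OF s]] by (auto simp: hom_def)
    \<comment> \<open>\<open>a\<close> and \<open>b\<close> are the components of the unit at
      \<open>u\<close> and \<open>v\<close>; the conjugation below uses their inverses.\<close>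
    define a where "a = \<eta> \<star> Id2 D u"
    define b where "b = \<eta> \<star> Id2 D v"
    have "invertible_cell D u (?q \<cdot> u) a" "invertible_cell D v (?q \<cdot> v) b"
      unfolding a_def b_def
      using invertible_HCmp_Id2[OF eta u'(1)] invertible_HCmp_Id2[OF eta v'(1)] i u' v'
        Idn_Cmp[OF u] Idn_Cmp[OF v] by simp_all
    then obtain a' b' where a: "a \<in> cells D u (?q \<cdot> u)" "a' \<in> cells D (?q \<cdot> u) u"
      "a \<bullet> a' = Id2 D (?q \<cdot> u)" and b: "b \<in> cells D v (?q \<cdot> v)" "b' \<in> cells D (?q \<cdot> v) v"
      "b \<bullet> b' = Id2 D (?q \<cdot> v)"
      unfolding invertible_cell_def by blast
    have td: "Id2 D t \<star> \<delta> \<in> cells D (?q \<cdot> u) (?q \<cdot> v)"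
      using whisker_cells[OF delta t'(1)] su t' assoc by simp
    define \<gamma> where "\<gamma> = b' \<bullet> ((Id2 D t \<star> \<delta>) \<bullet> a)"
    have tda: "(Id2 D t \<star> \<delta>) \<bullet> a \<in> cells D u (?q \<cdot> v)"
      using VCmp_cells[OF a(1) td] .
    have gamma: "\<gamma> \<in> cells D u v"
      unfolding \<gamma>_def using VCmp_cells[OF tda b(2)] .
    have qg: "Id2 D ?q \<star> \<gamma> \<in> cells D (?q \<cdot> u) (?q \<cdot> v)"
      using whisker_cells[OF gamma, of ?q] Cmp_hom[OF s' t] u' by (simp add: hom_def)
    have "\<eta> \<in> cells D (Idn D (Cod D u)) ?q"
      using eta u' by (simp add: invertible_cell_def)
    \<comment> \<open>Naturality compares \<open>\<gamma>\<close> with its whiskering by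
      \<open>t \<cdot> s\<close>. Inserting the definition of \<open>\<gamma>\<close> cancels
      \<open>b\<close> against \<open>b'\<close>, and composing with \<open>a'\<close> on the right
      then removes \<open>a\<close>.\<close>
    from unit_naturality[OF this gamma] have "(Id2 D ?q \<star> \<gamma>) \<bullet> a = b \<bullet> \<gamma>"
      by (simp add: a_def b_def)
    also have "\<dots> = (Id2 D t \<star> \<delta>) \<bullet> a"
      using VCmp_assoc[OF tda b(2) b(1)] b(3) Id2_VCmp[OF tda] by (simp add: \<gamma>_def)
    finally have "((Id2 D ?q \<star> \<gamma>) \<bullet> a) \<bullet> a' = ((Id2 D t \<star> \<delta>) \<bullet> a) \<bullet> a'"
      by simp
    then have "Id2 D ?q \<star> \<gamma> = Id2 D t \<star> \<delta>"
      using VCmp_assoc[OF a(2) a(1) qg] VCmp_assoc[OF a(2) a(1) td] a(3) VCmp_Id2[OF qg]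
        VCmp_Id2[OF td] by simp
    then have eq: "Id2 D t \<star> (Id2 D s \<star> \<gamma>) = Id2 D t \<star> \<delta>"
      using whisker_comp[OF gamma s t'(1)] u' t' by simp
    have sg: "Id2 D s \<star> \<gamma> \<in> cells D (s \<cdot> u) (s \<cdot> v)"
      using whisker_cells[OF gamma s] u' by simp
    \<comment> \<open>Here \<open>t\<close> takes the place of \<open>s\<close>, and
      \<open>\<epsilon>'\<close> that of the unit. No triangle identity relates
      \<open>\<eta>\<close> and \<open>\<epsilon>\<close>, so the equality is obtained by cancelling
      \<open>t\<close>.\<close>
    have "s \<in> hom D (Cod D t) (Dom D t)" "invertible_cell D (Idn D (Dom D t)) (s \<cdot> t) \<epsilon>'"
      "Cod D (s \<cdot> u) = Dom D t"
      using s' eps' t' su by simp_all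
    then have "Id2 D s \<star> \<gamma> = \<delta>"
      using whisker_injective[OF t'(1) _ _ sg delta _ eq] by blast
    then show ?thesis
      using gamma by blast
  qed
  have "Id2 D s \<star> \<gamma> \<in> cells D (s \<cdot> u) (s \<cdot> v)" if "\<gamma> \<in> cells D u v" for \<gamma>
    using whisker_cells[OF that s] u' by simp
  then show ?thesis
    using inj surj unfolding bij_betw_def by blast
qed

end

section \<open>Hats under a 2-functor that inverts \<open>\<Sigma>\<close>\<close>

lemma hom_locally_discrete [simp]: "hom (locally_discrete A) X Y = hom A X Y"
  by (simp add: hom_def locally_discrete_def)

text \<open>Fixes a single test 2-functor, so that hats can be compared for one \<open>D\<close> and
  \<open>F\<close> at a time; the quantification over all of them returns only in the
  theorem.\<close>

locale sigma_inverting =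
  two_functor "locally_discrete A" D F
  for A :: "('o, 'm) cat" and \<Sigma> :: "'m set"
    and D :: "('p, 'n, 'd) two_cat" and F :: "('o, 'm, 'm, 'p, 'n, 'd) two_map" +
  assumes inverts: "sends_to_equivalences F \<Sigma> D"
begin

lemma MArr_comp:
  "f \<in> hom A X Y \<Longrightarrow> g \<in> hom A Y Z \<Longrightarrow> MArr F (Cmp A g f) = Cmp D (MArr F g) (MArr F f)"
  using MArr_Cmp[of f X Y g Z] by (simp add: locally_discrete_def hom_def)

lemma MArr_in_hom: "f \<in> hom A X Y \<Longrightarrow> MArr F f \<in> hom D (MObj F X) (MObj F Y)"
  using MArr_hom[of f X Y] by simp

text \<open>Since \<open>s d0 = x = s d1\<close>, whiskering with \<open>Fs\<close> is a bijection
  onto the 2-cells from \<open>Fx\<close> to itself, and the identity has exactly one preimage. This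
  justifies the definite description in \<open>cyl_hat\<close>.\<close>

lemma cyl_hat_ex1:
  assumes "is_cylinder A \<Sigma> X C"
  shows "\<exists>!\<gamma>. \<gamma> \<in> cells D (MArr F (cd0 C)) (MArr F (cd1 C)) \<and>
     HCmp D (Id2 D (MArr F (cs C))) \<gamma> = Id2 D (MArr F (cx C))"
proof -
  let ?s = "MArr F (cs C)" and ?x = "MArr F (cx C)"
  have C: "cd0 C \<in> hom A X (cW C)" "cd1 C \<in> hom A X (cW C)" "cs C \<in> hom A (cW C) (cZ C)"
    "cx C \<in> hom A X (cZ C)" "cs C \<in> \<Sigma>" "Cmp A (cs C) (cd0 C) = cx C" "Cmp A (cs C) (cd1 C) = cx C"
    using assms by (auto simp: is_cylinder_def)
  have s: "equivalence D ?s" "Dom D ?s = MObj F (cW C)"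
    using inverts C(5) MArr_in_hom[OF C(3)] by (auto simp: sends_to_equivalences_def hom_def)
  let ?w = "\<lambda>\<gamma>. HCmp D (Id2 D ?s) \<gamma>" and ?S = "cells D (MArr F (cd0 C)) (MArr F (cd1 C))"
  have bij: "bij_betw ?w ?S (cells D ?x ?x)"
    using target.whisker_bijective[OF s(1), unfolded s(2), OF MArr_in_hom[OF C(1)] MArr_in_hom[OF C(2)]]
      MArr_comp[OF C(1) C(3)] MArr_comp[OF C(2) C(3)] C(6,7) by simp
  have "Id2 D ?x \<in> cells D ?x ?x"
    using target.Id2_cells MArr_in_hom[OF C(4)] by (simp add: hom_def)
  then have "Id2 D ?x \<in> ?w ` ?S"
    by (simp only: bij_betw_imp_surj_on[OF bij])
  then obtain \<gamma> where \<gamma>: "\<gamma> \<in> ?S" "?w \<gamma> = Id2 D ?x"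
    by (rule imageE) simp
  show ?thesis
  proof (rule ex1I)
    show "\<gamma> \<in> ?S \<and> ?w \<gamma> = Id2 D ?x"
      using \<gamma> by blast
    show "\<gamma>' = \<gamma>" if "\<gamma>' \<in> ?S \<and> ?w \<gamma>' = Id2 D ?x" for \<gamma>'
      using inj_onD[OF bij_betw_imp_inj_on[OF bij], of \<gamma>' \<gamma>] that \<gamma> by simp
  qed
qed

lemmas cyl_hat_props = theI'[OF cyl_hat_ex1, folded cyl_hat_def]

lemma cyl_hat_map:
  assumes C: "is_cylinder A \<Sigma> X C" and C': "is_cylinder A \<Sigma> X C'"
    and map: "is_cylinder_map A C C' \<phi> \<psi>"
  shows "HCmp D (Id2 D (MArr F \<phi>)) (cyl_hat D F C) = cyl_hat D F C'"
proof -
  have h: "cd0 C \<in> hom A X (cW C)" "cd1 C \<in> hom A X (cW C)" "cs C \<in> hom A (cW C) (cZ C)"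
    "cx C \<in> hom A X (cZ C)" "cs C' \<in> hom A (cW C') (cZ C')"
    using C C' by (auto simp: is_cylinder_def)
  have m: "\<phi> \<in> hom A (cW C) (cW C')" "\<psi> \<in> hom A (cZ C) (cZ C')" "Cmp A \<phi> (cd0 C) = cd0 C'"
    "Cmp A \<phi> (cd1 C) = cd1 C'" "Cmp A (cs C') \<phi> = Cmp A \<psi> (cs C)" "Cmp A \<psi> (cx C) = cx C'"
    using map by (auto simp: is_cylinder_map_def)
  note F = MArr_in_hom[OF h(1)] MArr_in_hom[OF h(3)] MArr_in_hom[OF h(4)] MArr_in_hom[OF h(5)]
    MArr_in_hom[OF m(1)] MArr_in_hom[OF m(2)]
  let ?c = "cyl_hat D F C" and ?w = "\<lambda>f. HCmp D (Id2 D (MArr F f))"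
  have c: "?c \<in> cells D (MArr F (cd0 C)) (MArr F (cd1 C))" "?w (cs C) ?c = Id2 D (MArr F (cx C))"
    using cyl_hat_props[OF C] by auto
  have "?w \<phi> ?c \<in> cells D (MArr F (cd0 C')) (MArr F (cd1 C'))"
    using target.whisker_cells[OF c(1), of "MArr F \<phi>"] F MArr_comp[OF h(1) m(1)]
      MArr_comp[OF h(2) m(1)] m(3,4) by (simp add: hom_def)
  moreover have "?w (cs C') (?w \<phi> ?c) = Id2 D (MArr F (cx C'))"
  proof -
    have "?w (cs C') (?w \<phi> ?c) = ?w (Cmp A (cs C') \<phi>) ?c"
      using target.whisker_comp[OF c(1), of "MArr F \<phi>" "MArr F (cs C')"] F MArr_comp[OF m(1) h(5)]
      by (simp add: hom_def)
    \<comment> \<open>The commuting square \<open>m(5)\<close> trades \<open>s' \<phi>\<close> for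
      \<open>\<psi> s\<close>, which brings in \<open>Fs\<close>, where the hat of \<open>C\<close>
      is known to become an identity.\<close>
    also have "\<dots> = ?w \<psi> (?w (cs C) ?c)"
      using target.whisker_comp[OF c(1), of "MArr F (cs C)" "MArr F \<psi>"] F MArr_comp[OF h(3) m(2)] m(5)
      by (simp add: hom_def)
    also have "\<dots> = Id2 D (MArr F (cx C'))"
      using target.Id2_HCmp_Id2[of "MArr F (cx C)" "MArr F \<psi>"] F MArr_comp[OF h(4) m(2)] m(6) c(2)
      by (simp add: hom_def)
    finally show ?thesis .
  qed
  ultimately show ?thesis
    using cyl_hat_ex1[OF C'] cyl_hat_props[OF C'] by blast
qed

text \<open>As \<open>h = h' \<phi>\<close>, whiskering the hat of the first cylinder with
  \<open>Fh\<close> amounts to whiskering with \<open>F\<phi>\<close>, which yields the hat of the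
  second cylinder, and then with \<open>Fh'\<close>.\<close>

lemma homotopy_hat_germ_step:
  assumes "germ_step A \<Sigma> X Y f g H H'"
  shows "homotopy_hat D F H = homotopy_hat D F H'"
proof -
  obtain \<phi> \<psi> where C: "is_cylinder A \<Sigma> X (hcyl H)" and C': "is_cylinder A \<Sigma> X (hcyl H')"
    and map: "is_cylinder_map A (hcyl H) (hcyl H') \<phi> \<psi>" and h: "Cmp A (hmap H') \<phi> = hmap H"
    and h': "hmap H' \<in> hom A (cW (hcyl H')) Y"
    using assms unfolding germ_step_def is_homotopy_def by blast
  have phi: "\<phi> \<in> hom A (cW (hcyl H)) (cW (hcyl H'))" and d: "cd0 (hcyl H) \<in> hom A X (cW (hcyl H))"
    using map C by (auto simp: is_cylinder_map_def is_cylinder_def)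
  have "HCmp D (Id2 D (MArr F (hmap H'))) (HCmp D (Id2 D (MArr F \<phi>)) (cyl_hat D F (hcyl H)))
      = homotopy_hat D F H"
    using target.whisker_comp[OF conjunct1[OF cyl_hat_props[OF C]], of "MArr F \<phi>" "MArr F (hmap H')"]
      MArr_in_hom[OF phi] MArr_in_hom[OF h'] MArr_in_hom[OF d] MArr_comp[OF phi h'] h
    by (simp add: homotopy_hat_def hom_def)
  then show ?thesis
    by (simp add: cyl_hat_map[OF C C' map] homotopy_hat_def)
qed

text \<open>Having equal hats is an equivalence relation, so it contains the one generated by the
  germ steps.\<close>

lemma homotopy_hat_germ_related:
  assumes "germ_related A \<Sigma> X Y f g H H'"
  shows "homotopy_hat D F H = homotopy_hat D F H'"
  using assms unfolding germ_related_def
  by (induction rule: equivclp_induct) (auto dest: homotopy_hat_germ_step)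

end

theorem lemma2p18:
  fixes A :: "('o, 'm) cat" and \<Sigma> :: "'m set" and X Y :: 'o and f g :: 'm
    and H H' :: "('o, 'm) homotopy"
  assumes "category A"
    and "\<Sigma> \<subseteq> Arr A"
    and "\<forall>V \<in> Obj A. Idn A V \<in> \<Sigma>"
    and "X \<in> Obj A" and "Y \<in> Obj A"
    and "f \<in> hom A X Y" and "g \<in> hom A X Y"
    and "is_homotopy A \<Sigma> X Y f g H" and "is_homotopy A \<Sigma> X Y f g H'"
    and "germ_related A \<Sigma> X Y f g H H'"
  shows "ho_class TYPE('p \<times> 'n \<times> 'd) A \<Sigma> X Y f g [H] = ho_class TYPE('p \<times> 'n \<times> 'd) A \<Sigma> X Y f g [H'] \<and>
    (\<forall>(D :: ('p, 'n, 'd) two_cat) F.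
       two_category D \<and> two_functor (locally_discrete A) D F \<and> sends_to_equivalences F \<Sigma> D
         \<longrightarrow> homotopy_hat D F H = homotopy_hat D F H')"
proof -
  have hat: "homotopy_hat D F H = homotopy_hat D F H'"
    if "two_category D \<and> two_functor (locally_discrete A) D F \<and> sends_to_equivalences F \<Sigma> D"
    for D :: "('p, 'n, 'd) two_cat" and F
  proof -
    interpret sigma_inverting A \<Sigma> D F
      using that by (simp add: sigma_inverting_def sigma_inverting_axioms_def)
    show ?thesis
      using assms(10) by (rule homotopy_hat_germ_related)
  qed
  \<comment> \<open>The composite of a one-term sequence is its hat followed by the identity 2-cell
    of \<open>Fg\<close>, so it depends on the homotopy only through the hat. The two classes
    therefore have the same membership condition.\<close>
  then have "ho_equiv TYPE('p \<times> 'n \<times> 'd) A \<Sigma> g [H] Hs \<longleftrightarrow> ho_equiv TYPE('p \<times> 'n \<times> 'd) A \<Sigma> g [H'] Hs" for Hs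
    unfolding ho_equiv_def by (metis seq_hat.simps)
  then show ?thesis
    using hat by (simp add: ho_class_def)
qed

end
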